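(* Let $\mathcal G$ be a connected unweighted graph on $n\ge3$ nodes with node set $\mathcal V_{\mathcal G}$, and let $$\sigma(\mathcal G):=\max_{i,j\in\mathcal V_{\mathcal G},\,i\ne j}\big\{d_i+d_j-|\mathfrak N(i)\cap\mathfrak N(j)|\big\},$$ where $d_i$ is the degree of node $i$ and $\mathfrak N(i)$ is the set of nodes adjacent to $i$. Then $$\rho_{ss}(L_{\mathcal G};M_n)\,\sigma(\mathcal G)\ \ge\ \frac{n-1}2.$$ Moreover, equality holds if $\mathcal G=\mathcal K_n$ (the complete graph).
   Context: Graphs are finite, simple, undirected. $L_{\mathcal G}$ is the graph Laplacian (degree matrix minus adjacency matrix) with eigenvalues $0=\lambda_1<\lambda_2\le\dots\le\lambda_n$, $M_n=I_n-\frac1nJ_n$ is the centering matrix, and $\rho_{ss}(L_{\mathcal G};M_n)=\frac12\sum_{i=2}^n\lambda_i^{-1}$ is the performance measure of the first-order consensus network $\dot x=-L_{\mathcal G}x+\xi$, $y=M_nx$. *)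

theory Defs
  imports
    "Graph_Theory.Graph_Theory"
    "Jordan_Normal_Form.Char_Poly"
begin

(* Finite simple undirected graphs are rendered by the locale predicate graph of Graph_Theory:
   finite, loop-free digraphs without parallel arcs and with a symmetric arc relation. An edge
   {u,v} is a pair of opposite arcs, so out_degree is the ordinary degree. *)

definition nbrs :: "('a, 'b) pre_digraph \<Rightarrow> 'a \<Rightarrow> 'a set" where
  "nbrs G v = {w. v \<rightarrow>\<^bsub>G\<^esub> w}"

(* The list vs enumerates the nodes; it fixes the order of rows and columns. *)

definition degree_mat :: "('a, 'b) pre_digraph \<Rightarrow> 'a list \<Rightarrow> real mat" where
  "degree_mat G vs = mat (length vs) (length vs)
     (\<lambda>(i, j). if i = j then real (out_degree G (vs ! i)) else 0)"

definition adjacency_mat :: "('a, 'b) pre_digraph \<Rightarrow> 'a list \<Rightarrow> real mat" where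
  "adjacency_mat G vs = mat (length vs) (length vs)
     (\<lambda>(i, j). if vs ! i \<rightarrow>\<^bsub>G\<^esub> vs ! j then 1 else 0)"

definition laplacian :: "('a, 'b) pre_digraph \<Rightarrow> 'a list \<Rightarrow> real mat" where
  "laplacian G vs = degree_mat G vs - adjacency_mat G vs"

(* The i-th smallest real eigenvalue, counted from i = 1 and with algebraic multiplicity.
   Only meaningful for 1 \<le> i \<le> dim_row A when all eigenvalues of A are real, as they are
   for symmetric A. *)

definition eigval :: "real mat \<Rightarrow> nat \<Rightarrow> real" where
  "eigval A i = sorted_list_of_multiset (proots (char_poly A)) ! (i - 1)"

(* The performance measure of dx/dt = - L x + xi, y = M x, where M = I - J/n is the centering
   matrix, for the Laplacian L of a connected graph on n = dim_row L nodes. *)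

definition rho_ss :: "real mat \<Rightarrow> real" where
  "rho_ss L = 1 / 2 * (\<Sum>i = 2..dim_row L. inverse (eigval L i))"

(* All pairs of distinct nodes are considered, adjacent or not. *)

definition sigma :: "('a, 'b) pre_digraph \<Rightarrow> real" where
  "sigma G = Max {real (out_degree G i) + real (out_degree G j) - real (card (nbrs G i \<inter> nbrs G j))
     | i j. i \<in> verts G \<and> j \<in> verts G \<and> i \<noteq> j}"

end

theory Submission
  imports Defs "Jordan_Normal_Form.Schur_Decomposition"
begin

text \<open>
  The inequality is a bound on every single eigenvalue: each nonzero eigenvalue \<open>k\<close> of the
  Laplacian satisfies \<open>0 < k \<le> \<sigma>\<close>, so each of the \<open>n - 1\<close> terms \<open>1 / k\<close> in
  \<open>2 \<rho>\<close> is at least \<open>1 / \<sigma>\<close>.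

  For the upper bound, let \<open>f\<close> be an eigenfunction of \<open>k\<close>, with maximum at \<open>i\<close> and minimum
  at \<open>j\<close>; it is not constant because the Laplacian kills constants. Subtracting the eigenvalue
  equations at \<open>i\<close> and \<open>j\<close> gives
  \<open>k (f i - f j) = (\<Sum>w\<in>N i. f i - f w) + (\<Sum>w\<in>N j. f w - f j)\<close>.
  A neighbour of only one of the two nodes contributes at most \<open>f i - f j\<close>, and a common neighbour
  contributes exactly that, because \<open>f w\<close> cancels. Hence \<open>k\<close> is at most the number of nodes in
  \<open>N i \<union> N j\<close>, which by inclusion-exclusion is the expression maximised in \<open>\<sigma>\<close>
  (lemma \<open>nonzero_eigenvalue_bounds\<close>). All summands are nonnegative, which gives \<open>k > 0\<close> as well.

  Since \<open>\<rho>\<close> is read off from the sorted real roots of the characteristic polynomial, the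
  argument also needs that there are \<open>n\<close> of them and that \<open>0\<close> is a root exactly once
  (lemma \<open>laplacian_spectrum\<close>). The first holds because the Laplacian is a real symmetric matrix.
  For the second, a multiple root of a symmetric matrix has two independent eigenvectors, whereas on
  a connected graph the kernel of the Laplacian consists of the constants only, by the maximum
  principle.

  On the complete graph the Laplacian maps \<open>f\<close> to \<open>n f\<close> minus the sum of \<open>f\<close>, so every
  nonzero eigenvalue equals \<open>n\<close>; the neighbourhoods of two distinct nodes cover
  all nodes, so \<open>\<sigma>\<close> equals \<open>n\<close> too and each term \<open>1 / k\<close> is exactly \<open>1 / \<sigma>\<close>.
\<close>

section \<open>Real symmetric matrices\<close>

text \<open>
  With \<open>v\<close> an eigenvector, the Hermitian form \<open>S = v\<^sup>* A v\<close> equals its own conjugate by symmetry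
  of \<open>A\<close>, and it equals \<open>z\<close> times the squared norm \<open>N\<close> of \<open>v\<close>.
\<close>
lemma eigenvalue_real_symmetric_in_Reals:
  fixes A :: "real mat"
  assumes A: "A \<in> carrier_mat n n" and sym: "transpose_mat A = A"
    and ev: "eigenvalue (map_mat complex_of_real A) z"
  shows "z \<in> \<real>"
proof -
  let ?A = "map_mat complex_of_real A"
  obtain v where v: "v \<in> carrier_vec n" "v \<noteq> 0\<^sub>v n" and Av: "?A *\<^sub>v v = z \<cdot>\<^sub>v v"
    using ev A unfolding eigenvalue_def eigenvector_def by auto
  define S where "S = (\<Sum>i<n. \<Sum>j<n. cnj (v $ i) * (complex_of_real (A $$ (i,j)) * v $ j))"
  define N where "N = (\<Sum>i<n. (cmod (v $ i))\<^sup>2)"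
  have row: "(\<Sum>j<n. complex_of_real (A $$ (i,j)) * v $ j) = z * v $ i" if i: "i < n" for i
  proof -
    have "(?A *\<^sub>v v) $ i = (\<Sum>j<n. complex_of_real (A $$ (i,j)) * v $ j)"
      using i A v by (auto simp: scalar_prod_def atLeast0LessThan intro!: sum.cong)
    then show ?thesis using Av i v by auto
  qed
  have entry_sym: "A $$ (i,j) = A $$ (j,i)" if "i < n" "j < n" for i j
    using index_transpose_mat(1)[of i A j] sym A that by auto
  have "S = (\<Sum>i<n. cnj (v $ i) * (z * v $ i))"
    unfolding S_def sum_distrib_left[symmetric] by (rule sum.cong) (auto simp: row)
  also have "\<dots> = z * of_real N"
    unfolding N_def of_real_sum sum_distrib_left
    by (rule sum.cong) (auto simp: complex_norm_square mult_ac simp del: of_real_power)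
  finally have S: "S = z * of_real N" .
  have "cnj S = (\<Sum>i<n. \<Sum>j<n. v $ i * (complex_of_real (A $$ (i,j)) * cnj (v $ j)))"
    unfolding S_def by simp
  also have "\<dots> = (\<Sum>j<n. \<Sum>i<n. v $ i * (complex_of_real (A $$ (i,j)) * cnj (v $ j)))"
    by (rule sum.swap)
  also have "\<dots> = S"
    unfolding S_def by (intro sum.cong refl) (auto simp: entry_sym mult_ac)
  finally have "cnj S = S" .
  moreover have "N \<noteq> 0"
  proof
    assume "N = 0"
    then have "\<forall>i<n. v $ i = 0"
      unfolding N_def by (subst (asm) sum_nonneg_eq_0_iff) auto
    then show False using v by auto
  qed
  ultimately have "cnj z = z" unfolding S by simp
  then show ?thesis by (simp add: Reals_cnj_iff)
qed

text \<open>
  Over the complex numbers the characteristic polynomial splits, and all its roots are real; the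
  factorisation descends because embedding the coefficients into the complex numbers is injective.
\<close>
lemma char_poly_real_symmetric_splits:
  fixes A :: "real mat"
  assumes A: "A \<in> carrier_mat n n" and sym: "transpose_mat A = A"
  obtains es where "char_poly A = (\<Prod>e\<leftarrow>es. [:- e, 1:])" "length es = n"
proof -
  interpret map_poly_hom: map_poly_comm_ring_hom complex_of_real ..
  let ?A = "map_mat complex_of_real A"
  have A': "?A \<in> carrier_mat n n" using A by simp
  obtain zs where zs: "char_poly ?A = (\<Prod>z\<leftarrow>zs. [:- z, 1:])" and len: "length zs = n"
    using char_poly_factorized[OF A'] by blast
  have real: "complex_of_real (Re z) = z" if "z \<in> set zs" for z
  proof -
    have "poly (char_poly ?A) z = 0"
      unfolding zs poly_prod_list prod_list_zero_iff using that by force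
    then have "eigenvalue ?A z" using eigenvalue_root_char_poly[OF A'] by blast
    then show ?thesis
      using eigenvalue_real_symmetric_in_Reals[OF A sym] by simp
  qed
  have hom: "map_poly complex_of_real (\<Prod>e\<leftarrow>map Re ys. [:- e, 1:]) = (\<Prod>z\<leftarrow>ys. [:- z, 1:])"
    if "\<forall>z\<in>set ys. complex_of_real (Re z) = z" for ys
    using that
    by (induction ys) (simp_all add: map_poly_hom.hom_mult hom_distribs del: mult_pCons_left)
  have "map_poly complex_of_real (char_poly A) = char_poly ?A"
    by (rule of_real_hom.char_poly_hom[OF A, symmetric])
  also have "\<dots> = map_poly complex_of_real (\<Prod>e\<leftarrow>map Re zs. [:- e, 1:])"
    using hom[of zs] real zs by simp
  finally have "char_poly A = (\<Prod>e\<leftarrow>map Re zs. [:- e, 1:])"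
    by (simp only: poly_eq_iff coeff_map_poly of_real_0 of_real_eq_iff simp_thms)
  then show ?thesis by (rule that) (simp add: len)
qed

text \<open>
  Algebraic multiplicity two forces geometric multiplicity two. In a Schur basis that lists the
  double root first, the first two basis vectors satisfy \<open>A v = k v\<close> and \<open>A w = b v + k w\<close>, and
  comparing \<open>A v \<bullet> w\<close> with \<open>v \<bullet> A w\<close> gives \<open>b = 0\<close>.
\<close>
lemma symmetric_double_root_independent_eigenvectors:
  fixes A :: "real mat"
  assumes A: "A \<in> carrier_mat n n" and sym: "transpose_mat A = A"
    and char: "char_poly A = (\<Prod>e\<leftarrow>k # k # es. [:- e, 1:])"
  obtains v w where "eigenvector A v k" "eigenvector A w k" "\<And>c. w \<noteq> c \<cdot>\<^sub>v v"
proof -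
  obtain B P Q where "schur_decomposition A (k # k # es) = (B, P, Q)"
    by (metis prod_cases3)
  from schur_decomposition[OF A char this]
  have sim: "similar_mat_wit A B P Q" and upper: "upper_triangular B"
    and diag: "diag_mat B = k # k # es" by auto
  note W = similar_mat_witD2[OF A sim]
  have "length (diag_mat B) = n" using W(5) by (auto simp: diag_mat_def)
  with diag have n: "1 < n" by auto
  have B: "B $$ (0,0) = k" "B $$ (1,1) = k"
  proof -
    have "B $$ (i,i) = (k # k # es) ! i" if "i < n" for i
      unfolding diag[symmetric] using that W(5) by (simp add: diag_mat_def)
    from this[of 0] this[of 1] n show "B $$ (0,0) = k" "B $$ (1,1) = k" by auto
  qed
  define b where "b = B $$ (0,1)"
  let ?e = "unit_vec n :: nat \<Rightarrow> real vec"
  define v where "v = P *\<^sub>v ?e 0"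
  define w where "w = P *\<^sub>v ?e 1"
  have carr: "v \<in> carrier_vec n" "w \<in> carrier_vec n" unfolding v_def w_def using W(6) by auto
  have Be0: "B *\<^sub>v ?e 0 = k \<cdot>\<^sub>v ?e 0"
    using n W(5) B upper by (intro eq_vecI) (auto simp: upper_triangular_def)
  have Be1: "B *\<^sub>v ?e 1 = b \<cdot>\<^sub>v ?e 0 + k \<cdot>\<^sub>v ?e 1"
    using n W(5) B upper
    by (intro eq_vecI) (auto simp: upper_triangular_def b_def)
  have "A * P = P * B * (Q * P)"
    unfolding W(3) using W(5,6,7) by (simp add: assoc_mult_mat[of _ n n _ n _ n])
  then have AP: "A * P = P * B" using W(2,5,6) by simp
  have A_P: "A *\<^sub>v (P *\<^sub>v x) = P *\<^sub>v (B *\<^sub>v x)" if x: "x \<in> carrier_vec n" for x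
    using arg_cong[OF AP, of "\<lambda>M. M *\<^sub>v x"] A W(5,6) x by simp
  have Av: "A *\<^sub>v v = k \<cdot>\<^sub>v v"
    unfolding v_def using A_P[of "?e 0"] Be0 mult_mat_vec[OF W(6), of "?e 0" k] by simp
  have Aw: "A *\<^sub>v w = b \<cdot>\<^sub>v v + k \<cdot>\<^sub>v w"
    unfolding v_def w_def using A_P[of "?e 1"] Be1 W(6)
    by (simp add: mult_add_distrib_mat_vec[OF W(6)] mult_mat_vec[OF W(6)])
  have QP: "Q *\<^sub>v (P *\<^sub>v x) = x" if x: "x \<in> carrier_vec n" for x
    using arg_cong[OF W(2), of "\<lambda>M. M *\<^sub>v x"] W(6,7) x by simp
  have v0: "v \<noteq> 0\<^sub>v n"
  proof
    assume "v = 0\<^sub>v n"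
    then have "?e 0 = Q *\<^sub>v 0\<^sub>v n" using QP[of "?e 0"] unfolding v_def by simp
    also have "\<dots> = 0\<^sub>v n" using W(7) by auto
    finally show False using n by simp
  qed
  have indep: "w \<noteq> c \<cdot>\<^sub>v v" for c
  proof
    assume "w = c \<cdot>\<^sub>v v"
    then have "?e 1 = Q *\<^sub>v (c \<cdot>\<^sub>v v)" using QP[of "?e 1"] unfolding w_def by simp
    also have "\<dots> = c \<cdot>\<^sub>v ?e 0"
      using mult_mat_vec[OF W(7) carr(1)] QP[of "?e 0"] unfolding v_def by simp
    finally have "?e 1 $ 1 = (c \<cdot>\<^sub>v ?e 0) $ 1" by simp
    then show False using n by simp
  qed
  have "(A *\<^sub>v v) \<bullet> w = v \<bullet> (A *\<^sub>v w)"
    using transpose_vec_mult_scalar[OF A carr(2,1)] sym by simp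
  then have "k * (v \<bullet> w) = b * (v \<bullet> v) + k * (v \<bullet> w)"
    unfolding Av Aw using carr by (simp add: scalar_prod_add_distrib[of _ n])
  moreover have "v \<bullet> v \<noteq> 0"
    using v0 carr conjugate_square_eq_0_vec[OF carr(1)] by simp
  ultimately have "b = 0" by simp
  then have "A *\<^sub>v w = k \<cdot>\<^sub>v w" unfolding Aw using carr by (intro eq_vecI) auto
  moreover have "w \<noteq> 0\<^sub>v n" using indep[of 0] carr by auto
  ultimately show ?thesis using that Av v0 carr A indep unfolding eigenvector_def by auto
qed

section \<open>The Laplacian as an operator on functions of the nodes\<close>

text \<open>
  Evaluating at nodes instead of list positions makes extremal nodes and paths easy to speak about.
\<close>
definition lap_op :: "('a, 'b) pre_digraph \<Rightarrow> ('a \<Rightarrow> real) \<Rightarrow> 'a \<Rightarrow> real" where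
  "lap_op G f u = (\<Sum>w\<in>nbrs G u. f u - f w)"

context graph
begin

lemma nbrs_subset_verts: "nbrs G u \<subseteq> verts G"
  unfolding nbrs_def using adj_in_verts by auto

lemma finite_nbrs: "finite (nbrs G u)"
  using nbrs_subset_verts finite_verts by (rule finite_subset)

lemma nbrs_irrefl: "u \<notin> nbrs G u"
  unfolding nbrs_def using adj_not_same by blast

lemma out_degree_eq_card_nbrs: "out_degree G u = card (nbrs G u)"
proof -
  have "bij_betw (head G) (out_arcs G u) (nbrs G u)"
    unfolding bij_betw_def inj_on_def nbrs_def out_arcs_def arcs_ends_conv
    using no_multi_arcs by (force simp: arc_to_ends_def)
  then show ?thesis unfolding out_degree_def by (rule bij_betw_same_card)
qed

lemma lap_op_const:
  assumes "\<And>u. u \<in> verts G \<Longrightarrow> f u = c" and "u \<in> verts G"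
  shows "lap_op G f u = 0"
  unfolding lap_op_def using assms nbrs_subset_verts[of u] by (intro sum.neutral) auto

lemma lap_op_at_max_nonneg:
  assumes "\<And>u. u \<in> verts G \<Longrightarrow> f u \<le> f i"
  shows "0 \<le> lap_op G f i"
  unfolding lap_op_def using assms nbrs_subset_verts[of i] by (intro sum_nonneg) auto

lemma lap_op_at_min_nonpos:
  assumes "\<And>u. u \<in> verts G \<Longrightarrow> f j \<le> f u"
  shows "lap_op G f j \<le> 0"
  unfolding lap_op_def using assms nbrs_subset_verts[of j] by (intro sum_nonpos) auto

text \<open>
  This is the heart of the bound. Both sums are extended by zero to the union of the neighbourhoods;
  then a common neighbour \<open>w\<close> contributes \<open>(f i - f w) + (f w - f j) = f i - f j\<close>, so it counts
  once and not twice.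
\<close>
lemma lap_op_max_minus_min_le:
  assumes max: "\<And>u. u \<in> verts G \<Longrightarrow> f u \<le> f i" and min: "\<And>u. u \<in> verts G \<Longrightarrow> f j \<le> f u"
  shows "lap_op G f i - lap_op G f j \<le> real (card (nbrs G i \<union> nbrs G j)) * (f i - f j)"
proof -
  let ?U = "nbrs G i \<union> nbrs G j"
  let ?a = "\<lambda>w. if w \<in> nbrs G i then f i - f w else 0"
  let ?b = "\<lambda>w. if w \<in> nbrs G j then f w - f j else 0"
  have "lap_op G f i = (\<Sum>w\<in>?U. ?a w)"
    unfolding lap_op_def by (rule sum.mono_neutral_cong_left) (auto simp: finite_nbrs)
  moreover have "- lap_op G f j = (\<Sum>w\<in>?U. ?b w)"
    unfolding lap_op_def sum_negf[symmetric]
    by (rule sum.mono_neutral_cong_left) (auto simp: finite_nbrs)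
  ultimately have "lap_op G f i - lap_op G f j = (\<Sum>w\<in>?U. ?a w + ?b w)"
    by (simp add: sum.distrib)
  also have "\<dots> \<le> (\<Sum>w\<in>?U. f i - f j)"
    using max min nbrs_subset_verts[of i] nbrs_subset_verts[of j] by (intro sum_mono) auto
  finally show ?thesis by simp
qed

text \<open>
  The maximum principle: where a harmonic function is maximal, the differences to the neighbours are
  nonnegative and add up to zero, so the maximum spreads along every path.
\<close>
lemma harmonic_imp_const:
  assumes conn: "connected G" and harm: "\<And>u. u \<in> verts G \<Longrightarrow> lap_op G f u = 0"
  obtains c where "\<And>u. u \<in> verts G \<Longrightarrow> f u = c"
proof -
  have sc: "strongly_connected G"
    using symmetric_connected_imp_strongly_connected[OF sym_arcs conn] .
  then have "verts G \<noteq> {}" by (auto simp: strongly_connected_def)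
  then obtain i where i: "i \<in> verts G" and max: "\<And>u. u \<in> verts G \<Longrightarrow> f u \<le> f i"
    using ex_is_arg_min_if_finite[OF finite_verts, of "\<lambda>u. - f u"] by (auto simp: is_arg_min_linorder)
  have "f u = f i" if u: "u \<in> verts G" for u
  proof -
    have "i \<rightarrow>\<^sup>*\<^bsub>G\<^esub> u" using sc i u by (auto simp: strongly_connected_def)
    then show ?thesis
    proof (induction rule: reachable_induct)
      case (step x y)
      have x: "x \<in> verts G" using step.hyps(2) by (rule adj_in_verts)
      have "y \<in> nbrs G x" using step.hyps(2) by (simp add: nbrs_def)
      moreover have "0 \<le> f x - f w" if "w \<in> nbrs G x" for w
        using max that nbrs_subset_verts[of x] step.IH by auto
      ultimately have "f x - f y = 0"
        using harm[OF x] finite_nbrs[of x] unfolding lap_op_def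
        by (subst (asm) sum_nonneg_eq_0_iff) auto
      then show ?case using step.IH by simp
    qed simp
  qed
  then show ?thesis using that by blast
qed

lemma nonzero_eigenfunction_extrema:
  assumes eig: "\<And>u. u \<in> verts G \<Longrightarrow> lap_op G f u = k * f u"
    and "k \<noteq> 0" and nz: "u \<in> verts G" "f u \<noteq> 0"
  obtains i j where "i \<in> verts G" "j \<in> verts G" "f j < f i"
    "\<And>u. u \<in> verts G \<Longrightarrow> f u \<le> f i" "\<And>u. u \<in> verts G \<Longrightarrow> f j \<le> f u"
proof -
  have ne: "verts G \<noteq> {}" using nz by auto
  obtain i where i: "i \<in> verts G" and max: "\<And>u. u \<in> verts G \<Longrightarrow> f u \<le> f i"
    using ex_is_arg_min_if_finite[OF finite_verts ne, of "\<lambda>u. - f u"]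
    by (auto simp: is_arg_min_linorder)
  obtain j where j: "j \<in> verts G" and min: "\<And>u. u \<in> verts G \<Longrightarrow> f j \<le> f u"
    using ex_is_arg_min_if_finite[OF finite_verts ne, of f] by (auto simp: is_arg_min_linorder)
  have "f j \<noteq> f i"
  proof
    assume "f j = f i"
    then have "\<And>w. w \<in> verts G \<Longrightarrow> f w = f i" using max min by (metis order_antisym)
    then have "lap_op G f u = 0" using lap_op_const nz(1) by blast
    then show False using eig[OF nz(1)] nz(2) \<open>k \<noteq> 0\<close> by simp
  qed
  with max[OF j] have "f j < f i" by simp
  then show ?thesis using that i j max min by blast
qed

text \<open>
  Inclusion-exclusion identifies the quantity maximised in \<open>sigma\<close> with the one that bounds the
  eigenvalues.
\<close>
lemma sigma_summand_eq_card_Un: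
  "real (out_degree G i) + real (out_degree G j) - real (card (nbrs G i \<inter> nbrs G j))
   = real (card (nbrs G i \<union> nbrs G j))"
  using card_Un_Int[OF finite_nbrs finite_nbrs, of i j]
  unfolding out_degree_eq_card_nbrs by linarith

lemma sigma_eq_Max_card_Un:
  "sigma G = Max {real (card (nbrs G i \<union> nbrs G j)) | i j. i \<in> verts G \<and> j \<in> verts G \<and> i \<noteq> j}"
  unfolding sigma_def sigma_summand_eq_card_Un ..

lemma card_nbrs_Un_le_sigma:
  assumes "i \<in> verts G" "j \<in> verts G" "i \<noteq> j"
  shows "real (card (nbrs G i \<union> nbrs G j)) \<le> sigma G"
proof -
  let ?S = "{real (card (nbrs G i \<union> nbrs G j)) | i j. i \<in> verts G \<and> j \<in> verts G \<and> i \<noteq> j}"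
  have "?S \<subseteq> (\<lambda>(i, j). real (card (nbrs G i \<union> nbrs G j))) ` (verts G \<times> verts G)" by auto
  then have "finite ?S" by (rule finite_subset) simp
  then show ?thesis unfolding sigma_eq_Max_card_Un using assms by (intro Max_ge) auto
qed

text \<open>
  The function \<open>f\<close> has Laplacian at least zero at a maximum and at most zero at a minimum, so the
  sign of \<open>k\<close> comes from the same pair of nodes as its upper bound.
\<close>
lemma nonzero_eigenvalue_bounds:
  assumes eig: "\<And>u. u \<in> verts G \<Longrightarrow> lap_op G f u = k * f u"
    and "k \<noteq> 0" and nz: "u \<in> verts G" "f u \<noteq> 0"
  shows "0 < k" and "k \<le> sigma G"
proof -
  obtain i j where ij: "i \<in> verts G" "j \<in> verts G" "f j < f i"
    and max: "\<And>u. u \<in> verts G \<Longrightarrow> f u \<le> f i" and min: "\<And>u. u \<in> verts G \<Longrightarrow> f j \<le> f u"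
    using nonzero_eigenfunction_extrema[OF assms] by metis
  have diff: "lap_op G f i - lap_op G f j = k * (f i - f j)"
    using eig ij by (simp add: algebra_simps)
  have "0 \<le> k * (f i - f j)"
    using lap_op_at_max_nonneg[of f i] lap_op_at_min_nonpos[of f j] max min diff by fastforce
  then show "0 < k" using ij(3) \<open>k \<noteq> 0\<close> by (simp add: zero_le_mult_iff)
  have "k * (f i - f j) \<le> real (card (nbrs G i \<union> nbrs G j)) * (f i - f j)"
    using lap_op_max_minus_min_le[of f i j] max min diff by simp
  then have "k \<le> real (card (nbrs G i \<union> nbrs G j))" using ij(3) by simp
  also have "\<dots> \<le> sigma G" using ij by (intro card_nbrs_Un_le_sigma) auto
  finally show "k \<le> sigma G" .
qed

lemma complete_nbrs:
  assumes "K\<^bsub>n\<^esub> G" "u \<in> verts G"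
  shows "nbrs G u = verts G - {u}"
  using assms unfolding complete_digraph_def nbrs_def by auto

lemma sigma_complete:
  assumes K: "K\<^bsub>n\<^esub> G" and n: "n \<ge> 2"
  shows "sigma G = real n"
proof -
  have c: "card (verts G) = n" using K by (simp add: complete_digraph_def)
  obtain a b where ab: "a \<in> verts G" "b \<in> verts G" "a \<noteq> b"
    using c n by (metis card_2_iff' card_le_Suc0_iff_eq finite_verts not_less_eq_eq numeral_2_eq_2)
  have "nbrs G i \<union> nbrs G j = verts G" if "i \<in> verts G" "j \<in> verts G" "i \<noteq> j" for i j
    using complete_nbrs[OF K] that by auto
  then have "{real (card (nbrs G i \<union> nbrs G j)) | i j. i \<in> verts G \<and> j \<in> verts G \<and> i \<noteq> j} = {real n}"
    using ab c by (auto; metis)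
  then show ?thesis unfolding sigma_eq_Max_card_Un by simp
qed

text \<open>
  Here \<open>lap_op G f w\<close> is \<open>n * f w\<close> minus a quantity that does not depend on \<open>w\<close>, which cancels
  between two nodes where \<open>f\<close> differs.
\<close>
lemma complete_nonzero_eigenvalue:
  assumes K: "K\<^bsub>n\<^esub> G" and eig: "\<And>u. u \<in> verts G \<Longrightarrow> lap_op G f u = k * f u"
    and "k \<noteq> 0" and nz: "u \<in> verts G" "f u \<noteq> 0"
  shows "k = real n"
proof -
  obtain i j where ij: "i \<in> verts G" "j \<in> verts G" "f j < f i"
    using nonzero_eigenfunction_extrema[OF eig \<open>k \<noteq> 0\<close> nz] by metis
  have "lap_op G f w = real n * f w - sum f (verts G)" if w: "w \<in> verts G" for w
  proof -
    have "lap_op G f w = (\<Sum>x\<in>verts G. f w - f x)"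
      unfolding lap_op_def complete_nbrs[OF K w]
      by (rule sum.mono_neutral_left) auto
    then show ?thesis using K by (simp add: sum_subtractf complete_digraph_def)
  qed
  from this[OF ij(1)] this[OF ij(2)] have "k * (f i - f j) = real n * (f i - f j)"
    using eig[OF ij(1)] eig[OF ij(2)] by (simp add: right_diff_distrib)
  then show ?thesis using ij(3) by simp
qed

section \<open>The spectrum of the Laplacian matrix\<close>

lemma laplacian_carrier: "laplacian G vs \<in> carrier_mat (length vs) (length vs)"
  unfolding laplacian_def degree_mat_def adjacency_mat_def by auto

lemma transpose_laplacian: "transpose_mat (laplacian G vs) = laplacian G vs"
  unfolding laplacian_def degree_mat_def adjacency_mat_def
  by (intro eq_matI) (auto dest: arcs_ends_symmetric[OF sym_arcs])

lemma laplacian_mult_vec: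
  assumes vs: "distinct vs" "set vs = verts G" and i: "i < length vs"
  shows "(laplacian G vs *\<^sub>v vec (length vs) (\<lambda>i. f (vs ! i))) $ i = lap_op G f (vs ! i)"
proof -
  let ?n = "length vs" and ?u = "vs ! i"
  let ?adj = "\<lambda>w. if w \<in> nbrs G ?u then f w else 0"
  have bij: "bij_betw ((!) vs) {..<?n} (verts G)"
    using vs by (metis bij_betw_nth lessThan_atLeast0)
  have "(laplacian G vs *\<^sub>v vec ?n (\<lambda>i. f (vs ! i))) $ i
      = (\<Sum>j<?n. ((if i = j then real (out_degree G ?u) else 0)
                 - (if vs ! j \<in> nbrs G ?u then 1 else 0)) * f (vs ! j))"
    using i unfolding laplacian_def degree_mat_def adjacency_mat_def
    by (auto simp: scalar_prod_def nbrs_def atLeast0LessThan intro!: sum.cong)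
  also have "\<dots> = (\<Sum>j<?n. (if i = j then real (out_degree G ?u) * f (vs ! j) else 0) - ?adj (vs ! j))"
    by (intro sum.cong) (auto simp: algebra_simps)
  also have "\<dots> = real (out_degree G ?u) * f ?u - (\<Sum>j<?n. ?adj (vs ! j))"
    using i by (simp add: sum_subtractf)
  also have "(\<Sum>j<?n. ?adj (vs ! j)) = (\<Sum>w\<in>verts G. ?adj w)"
    using sum.reindex_bij_betw[OF bij, of ?adj] .
  also have "\<dots> = (\<Sum>w\<in>nbrs G ?u. f w)"
    by (rule sum.mono_neutral_cong_right) (use nbrs_subset_verts in auto)
  finally show ?thesis
    unfolding lap_op_def out_degree_eq_card_nbrs by (simp add: sum_subtractf)
qed

text \<open>Every vector indexed by list positions comes from a function on nodes, as \<open>vs\<close> is distinct.\<close>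
lemma eigenvector_laplacianE:
  assumes vs: "distinct vs" "set vs = verts G" and ev: "eigenvector (laplacian G vs) x k"
  obtains f u where "x = vec (length vs) (\<lambda>i. f (vs ! i))"
    "\<And>u. u \<in> verts G \<Longrightarrow> lap_op G f u = k * f u" "u \<in> verts G" "f u \<noteq> 0"
proof -
  let ?n = "length vs"
  have x: "x \<in> carrier_vec ?n" "x \<noteq> 0\<^sub>v ?n" "laplacian G vs *\<^sub>v x = k \<cdot>\<^sub>v x"
    using ev laplacian_carrier[of vs] unfolding eigenvector_def by auto
  define f where "f u = x $ (THE i. i < ?n \<and> vs ! i = u)" for u
  have f: "f (vs ! i) = x $ i" if "i < ?n" for i
  proof -
    have "(THE j. j < ?n \<and> vs ! j = vs ! i) = i"
      using that vs(1) by (auto simp: nth_eq_iff_index_eq)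
    then show ?thesis by (simp add: f_def)
  qed
  have xf: "x = vec ?n (\<lambda>i. f (vs ! i))" using x(1) f by (intro eq_vecI) auto
  have node: "\<exists>i<?n. u = vs ! i" if "u \<in> verts G" for u
    using that vs(2) by (metis in_set_conv_nth)
  have eig: "lap_op G f u = k * f u" if u: "u \<in> verts G" for u
  proof -
    obtain i where i: "i < ?n" "u = vs ! i" using node[OF u] by blast
    have "lap_op G f u = (laplacian G vs *\<^sub>v x) $ i"
      using laplacian_mult_vec[OF vs i(1), of f] xf i by simp
    also have "\<dots> = k * x $ i" unfolding x(3) using i(1) x(1) by simp
    finally show ?thesis using f[OF i(1)] i(2) by simp
  qed
  have "\<exists>i<?n. x $ i \<noteq> 0"
    using x(1,2) by (metis carrier_vecD eq_vecI index_zero_vec(1,2))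
  then obtain i where "i < ?n" "x $ i \<noteq> 0" by blast
  then have "vs ! i \<in> verts G" "f (vs ! i) \<noteq> 0" using f vs(2) by auto
  then show ?thesis using that xf eig by blast
qed

lemma proots_prod_linear: "proots (\<Prod>e\<leftarrow>es. [:- e, 1:]) = mset (es :: real list)"
proof (induction es)
  case (Cons e es)
  have "[:- e, 1:] \<noteq> 0" "(\<Prod>e\<leftarrow>es. [:- e, 1:]) \<noteq> (0 :: real poly)"
    by (auto simp: prod_list_zero_iff)
  then show ?case using Cons.IH by (simp add: proots_mult del: mult_pCons_left)
qed simp

text \<open>
  The constants give one root \<open>0\<close>. A second one would give two independent eigenvectors for \<open>0\<close>,
  but both would be constant.
\<close>
lemma laplacian_spectrum:
  assumes conn: "connected G" and vs: "distinct vs" "set vs = verts G"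
  obtains ks where "proots (char_poly (laplacian G vs)) = add_mset 0 (mset ks)"
    "Suc (length ks) = length vs"
    "\<And>k. k \<in> set ks \<Longrightarrow> k \<noteq> 0 \<and> (\<exists>f. (\<forall>u\<in>verts G. lap_op G f u = k * f u) \<and> (\<exists>u\<in>verts G. f u \<noteq> 0))"
proof -
  let ?L = "laplacian G vs" and ?n = "length vs"
  have "verts G \<noteq> {}"
    using symmetric_connected_imp_strongly_connected[OF sym_arcs conn]
    by (auto simp: strongly_connected_def)
  then have n: "0 < ?n" using vs by auto
  obtain es where es: "char_poly ?L = (\<Prod>e\<leftarrow>es. [:- e, 1:])" "length es = ?n"
    using char_poly_real_symmetric_splits[OF laplacian_carrier transpose_laplacian] .
  have root: "e \<in> set es \<longleftrightarrow> eigenvalue ?L e" for e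
    unfolding eigenvalue_root_char_poly[OF laplacian_carrier] es(1) poly_prod_list prod_list_zero_iff
    by force
  let ?one = "vec ?n (\<lambda>i. 1 :: real)"
  have "?L *\<^sub>v ?one = 0 \<cdot>\<^sub>v ?one"
  proof (rule eq_vecI)
    fix i assume "i < dim_vec (0 \<cdot>\<^sub>v ?one)"
    then have i: "i < ?n" by simp
    then have "(?L *\<^sub>v ?one) $ i = lap_op G (\<lambda>_. 1) (vs ! i)"
      using laplacian_mult_vec[OF vs i, of "\<lambda>_. 1"] by simp
    also have "\<dots> = 0" by (simp add: lap_op_def)
    finally show "(?L *\<^sub>v ?one) $ i = (0 \<cdot>\<^sub>v ?one) $ i" using i by simp
  qed (use laplacian_carrier[of vs] in auto)
  moreover have "?one \<noteq> 0\<^sub>v ?n"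
    using n by (metis index_vec index_zero_vec(1) zero_neq_one)
  ultimately have "eigenvector ?L ?one 0"
    using laplacian_carrier[of vs] unfolding eigenvector_def by auto
  then have "0 \<in> set es" unfolding root eigenvalue_def by blast
  define ks where "ks = remove1 0 es"
  have mset: "mset es = add_mset 0 (mset ks)" using \<open>0 \<in> set es\<close> unfolding ks_def by simp
  have nonzero: "0 \<notin> set ks"
  proof
    assume in_ks: "0 \<in> set ks"
    define ls where "ls = remove1 0 ks"
    have "mset es = mset (0 # 0 # ls)" using mset in_ks unfolding ls_def by simp
    then have "mset (map (\<lambda>e. [:- e, 1:]) es) = mset (map (\<lambda>e. [:- e, 1:]) (0 # 0 # ls))"
      by simp
    then have "(\<Prod>e\<leftarrow>es. [:- e, 1:]) = (\<Prod>e\<leftarrow>0 # 0 # ls. [:- e, 1:])"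
      by (metis prod_mset_prod_list)
    then have "char_poly ?L = (\<Prod>e\<leftarrow>0 # 0 # ls. [:- e, 1:])" using es(1) by simp
    then obtain v w where v: "eigenvector ?L v 0" and w: "eigenvector ?L w 0"
      and indep: "\<And>c. w \<noteq> c \<cdot>\<^sub>v v"
      using symmetric_double_root_independent_eigenvectors[OF laplacian_carrier transpose_laplacian]
      by metis
    have const: "\<exists>c. c \<noteq> 0 \<and> x = vec ?n (\<lambda>_. c)" if "eigenvector ?L x 0" for x
    proof -
      obtain f u where f: "x = vec ?n (\<lambda>i. f (vs ! i))"
        "\<And>u. u \<in> verts G \<Longrightarrow> lap_op G f u = 0 * f u" "u \<in> verts G" "f u \<noteq> 0"
        using eigenvector_laplacianE[OF vs \<open>eigenvector ?L x 0\<close>] by metis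
      then obtain c where c: "\<And>u. u \<in> verts G \<Longrightarrow> f u = c"
        using harmonic_imp_const[OF conn, of f] by auto
      then have "x = vec ?n (\<lambda>_. c)" unfolding f(1) using vs(2) by (intro eq_vecI) (auto intro!: c)
      then show ?thesis using c f(3,4) by blast
    qed
    obtain a b where "a \<noteq> 0" "v = vec ?n (\<lambda>_. a)" "w = vec ?n (\<lambda>_. b)"
      using const[OF v] const[OF w] by blast
    then have "w = (b / a) \<cdot>\<^sub>v v" by (intro eq_vecI) auto
    then show False using indep by blast
  qed
  have "k \<noteq> 0 \<and> (\<exists>f. (\<forall>u\<in>verts G. lap_op G f u = k * f u) \<and> (\<exists>u\<in>verts G. f u \<noteq> 0))"
    if k: "k \<in> set ks" for k
  proof -
    have "k \<in> set es" using k unfolding ks_def by (rule set_remove1_subset[THEN subsetD])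
    then obtain x where "eigenvector ?L x k" unfolding root eigenvalue_def by blast
    then show ?thesis using eigenvector_laplacianE[OF vs] nonzero k by metis
  qed
  moreover have "proots (char_poly ?L) = add_mset 0 (mset ks)"
    unfolding es(1) proots_prod_linear mset ..
  moreover have "Suc (length ks) = ?n"
    using es(2) arg_cong[OF mset, of size] by simp
  ultimately show ?thesis using that by blast
qed

text \<open>
  Positivity of \<open>ks\<close> puts the root \<open>0\<close> first in the sorted list of roots, so the sum in
  \<open>rho_ss\<close>, which starts at the second smallest root, runs exactly over \<open>ks\<close>.
\<close>
lemma rho_ss_laplacian:
  assumes ks: "proots (char_poly (laplacian G vs)) = add_mset 0 (mset ks)"
    and len: "Suc (length ks) = length vs" and pos: "\<And>k. k \<in> set ks \<Longrightarrow> 0 < k"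
  shows "rho_ss (laplacian G vs) = 1 / 2 * (\<Sum>k\<leftarrow>ks. inverse k)"
proof -
  have "sorted_list_of_multiset (add_mset 0 (mset ks)) = sort (0 # ks)"
    by (metis mset.simps(2) sorted_list_of_multiset_mset)
  also have "\<dots> = 0 # sort ks"
    using pos by (simp add: insort_is_Cons less_imp_le)
  finally have ev: "eigval (laplacian G vs) (Suc (Suc i)) = sort ks ! i" for i
    unfolding eigval_def ks by simp
  have "dim_row (laplacian G vs) = Suc (length ks)"
    using laplacian_carrier[of vs] len by simp
  then have "(\<Sum>i = 2..dim_row (laplacian G vs). inverse (eigval (laplacian G vs) i))
      = (\<Sum>i = 2..<length ks + 2. inverse (eigval (laplacian G vs) i))"
    by (simp add: atLeastLessThanSuc_atLeastAtMost)
  also have "\<dots> = (\<Sum>i = 0..<length ks. inverse (eigval (laplacian G vs) (i + 2)))"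
    using sum.shift_bounds_nat_ivl[of "\<lambda>i. inverse (eigval (laplacian G vs) i)" 0 2 "length ks"]
    by (simp only: add_0_left)
  also have "\<dots> = (\<Sum>i = 0..<length ks. inverse (sort ks ! i))"
    by (simp add: ev)
  also have "\<dots> = (\<Sum>k\<leftarrow>sort ks. inverse k)"
    by (simp add: sum_list_sum_nth)
  also have "\<dots> = (\<Sum>k\<leftarrow>ks. inverse k)"
    by (metis mset_map mset_sort sum_mset_sum_list)
  finally show ?thesis unfolding rho_ss_def by simp
qed

end

theorem theorem17:
  fixes G :: "('a, 'b) pre_digraph" and vs :: "'a list" and n :: nat
  assumes "graph G" and "connected G"
    and "card (verts G) = n" and "n \<ge> 3"
    and "distinct vs" and "set vs = verts G"
  shows "rho_ss (laplacian G vs) * sigma G \<ge> (real n - 1) / 2 \<and>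
    (K\<^bsub>n\<^esub> G \<longrightarrow> rho_ss (laplacian G vs) * sigma G = (real n - 1) / 2)"
proof -
  interpret graph G by fact
  have n: "length vs = n" using assms(3,5,6) distinct_card by metis
  obtain ks where ks: "proots (char_poly (laplacian G vs)) = add_mset 0 (mset ks)"
    and len: "Suc (length ks) = length vs"
    and eig: "\<And>k. k \<in> set ks \<Longrightarrow> k \<noteq> 0 \<and>
      (\<exists>f. (\<forall>u\<in>verts G. lap_op G f u = k * f u) \<and> (\<exists>u\<in>verts G. f u \<noteq> 0))"
    using laplacian_spectrum[OF assms(2,5,6)] by metis
  have len': "real (length ks) = real n - 1" using len n by linarith
  have bounds: "0 < k" "k \<le> sigma G" if "k \<in> set ks" for k
    using eig[OF that] nonzero_eigenvalue_bounds by blast+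
  have rho: "rho_ss (laplacian G vs) = 1 / 2 * (\<Sum>k\<leftarrow>ks. inverse k)"
    using rho_ss_laplacian[OF ks len bounds(1)] .
  have "(\<Sum>k\<leftarrow>ks. 1) \<le> (\<Sum>k\<leftarrow>ks. inverse k * sigma G)"
    using bounds by (intro sum_list_mono) (auto simp: field_simps)
  then have "(real n - 1) / 2 \<le> rho_ss (laplacian G vs) * sigma G"
    unfolding rho sum_list_mult_const using len' by (simp add: sum_list_triv)
  moreover have "rho_ss (laplacian G vs) * sigma G = (real n - 1) / 2" if K: "K\<^bsub>n\<^esub> G"
  proof -
    have "k = real n" if "k \<in> set ks" for k
      using eig[OF that] complete_nonzero_eigenvalue[OF K] by blast
    then have "(\<Sum>k\<leftarrow>ks. inverse k) = (\<Sum>k\<leftarrow>ks. inverse (real n))"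
      by (metis (mono_tags, lifting) map_eq_conv)
    then show ?thesis
      unfolding rho using sigma_complete[OF K] assms(4) len' by (simp add: sum_list_triv)
  qed
  ultimately show ?thesis by blast
qed

end
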